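(* Let $C \in \mathbb{R}^{n\times n}$ be a matrix with nonnegative entries, let $X^0 \in \mathring{\mathbb{X}}$, and let $(\alpha_k)_{k \ge 0}$ be a sequence of positive learning rates such that $$\lim_{k\to\infty}\alpha_k = 0,\qquad \sum_{k=0}^\infty \alpha_k = +\infty,\qquad \sum_{k=0}^\infty \alpha_k\,(\exp\{\alpha_k\}-1) < \infty .$$ Let $X^{k+1} = T_{\alpha_k}(X^k)$ for $k\ge 0$ be the Hedge iterates, and let $\bar X^K = \frac{1}{A_K}\sum_{k=0}^K \alpha_k X^k$ with $A_K=\sum_{k=0}^K\alpha_k$. Let $X^*$ be an arbitrary limit point of $\{\bar X^K\}$, let $\mathcal{K}^+(X^* )=\{i\in\{1,\dots,n\}: X^*(i)>0\}$ and $m=|\mathcal{K}^+(X^* )|$. Then, ranking the pure strategies $i\in\{1,\dots,n\}$ in decreasing order of their average probability mass $\bar X^K(i)$, for infinitely many $K$ the top-$m$ pure strategies in the ranking are exactly the elements of $\mathcal{K}^+(X^* )$.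
   Context: $C\in\mathbb{R}^{n\times n}$ is the payoff matrix of the symmetric bimatrix game $(C,C^T)$. $\mathbb{X}=\{X\in\mathbb{R}^n: X\ge 0,\ \sum_i X(i)=1\}$ is the simplex of mixed strategies and $\mathring{\mathbb{X}}$ is its relative interior (all coordinates positive). For $\alpha>0$ the Hedge map is $T_\alpha(X)(i) = X(i)\,\dfrac{\exp\{\alpha (CX)_i\}}{\sum_{j=1}^n X(j)\exp\{\alpha (CX)_j\}}$, $i=1,\dots,n$, where $(CX)_i$ is the $i$-th coordinate of $CX$. A limit point of a sequence is the limit of a convergent subsequence. *)

theory Defs
  imports "HOL-Analysis.Analysis"
begin

definition mixed_strategies :: "(real ^ 'n) set" where
  "mixed_strategies = {X. (\<forall>i. 0 \<le> X $ i) \<and> (\<Sum>i\<in>UNIV. X $ i) = 1}"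

definition hedge :: "real ^ 'n ^ 'n \<Rightarrow> real \<Rightarrow> real ^ 'n \<Rightarrow> real ^ 'n" where
  "hedge C a X =
     (\<chi> i. X $ i * (exp (a * (C *v X) $ i) / (\<Sum>j\<in>UNIV. X $ j * exp (a * (C *v X) $ j))))"

definition weighted_avg :: "(nat \<Rightarrow> real) \<Rightarrow> (nat \<Rightarrow> real ^ 'n) \<Rightarrow> nat \<Rightarrow> real ^ 'n" where
  "weighted_avg \<alpha> X K = (1 / (\<Sum>k\<le>K. \<alpha> k)) *\<^sub>R (\<Sum>k\<le>K. \<alpha> k *\<^sub>R X k)"

definition limit_point_of_seq :: "(nat \<Rightarrow> 'a::topological_space) \<Rightarrow> 'a \<Rightarrow> bool" where
  "limit_point_of_seq Y L \<longleftrightarrow> (\<exists>r. strict_mono r \<and> (Y \<circ> r) \<longlonglongrightarrow> L)"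

definition pos_support :: "real ^ 'n \<Rightarrow> 'n set" where
  "pos_support X = {i. 0 < X $ i}"

text \<open>A ranking lists every pure strategy exactly once, by non-increasing mass. Strategies
  of equal mass may come in any order, so several rankings can exist.\<close>

definition is_ranking :: "real ^ 'n \<Rightarrow> 'n list \<Rightarrow> bool" where
  "is_ranking X rs \<longleftrightarrow>
     distinct rs \<and> set rs = UNIV \<and> sorted_wrt (\<lambda>i j. X $ i \<ge> X $ j) rs"

lemma is_ranking_exists: "\<exists>rs. is_ranking (X :: real ^ 'n) rs"
proof -
  obtain xs :: "'n list" where xs: "set xs = UNIV" "distinct xs"
    using finite_distinct_list[OF finite] by blast
  let ?rs = "sort_key (\<lambda>i. - (X $ i)) xs"
  have "sorted_wrt (\<lambda>i j. X $ i \<ge> X $ j) ?rs"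
    using sorted_sort_key[of "\<lambda>i. - (X $ i)" xs] by (simp add: sorted_map)
  then show ?thesis
    using xs unfolding is_ranking_def by (intro exI[of _ ?rs]) simp
qed

lemma convex_mixed_strategies: "convex (mixed_strategies :: (real ^ 'n) set)"
  unfolding convex_def mixed_strategies_def
  by (auto simp: sum.distrib simp flip: sum_distrib_left)

lemma axis_mixed_strategies: "axis i 1 \<in> (mixed_strategies :: (real ^ 'n) set)"
  by (auto simp: mixed_strategies_def axis_def)

lemma rel_interior_mixed_strategies:
  "rel_interior (mixed_strategies :: (real ^ 'n) set) = {X \<in> mixed_strategies. \<forall>i. 0 < X $ i}"
proof (intro set_eqI iffI)
  fix z :: "real ^ 'n"
  assume z: "z \<in> rel_interior mixed_strategies"
  have "0 < z $ i" for i
  proof -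
    obtain e where e: "e > 1" "(1 - e) *\<^sub>R axis i 1 + e *\<^sub>R z \<in> mixed_strategies"
      using z axis_mixed_strategies convex_rel_interior_iff[OF convex_mixed_strategies]
      by (metis empty_iff)
    then have "0 \<le> (1 - e) + e * z $ i"
      unfolding mixed_strategies_def by (auto simp: axis_def dest: spec[of _ i])
    with e(1) have "0 < e * z $ i" by linarith
    with e(1) show ?thesis by (simp add: zero_less_mult_iff)
  qed
  then show "z \<in> {X \<in> mixed_strategies. \<forall>i. 0 < X $ i}"
    using z rel_interior_subset by blast
next
  fix z :: "real ^ 'n"
  assume z: "z \<in> {X \<in> mixed_strategies. \<forall>i. 0 < X $ i}"
  define d where "d = Min (range (($) z))"
  have d: "d > 0" "\<And>i. d \<le> z $ i"
    using z by (auto simp: d_def)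
  have "\<exists>e>1. (1 - e) *\<^sub>R x + e *\<^sub>R z \<in> mixed_strategies" if x: "x \<in> mixed_strategies" for x
  proof (intro exI conjI)
    show "1 < 1 + d" using d by simp
    have "0 \<le> - d * x $ i + (1 + d) * z $ i" for i
    proof -
      have "x $ i \<le> 1"
        using x member_le_sum[of i UNIV "($) x"] by (auto simp: mixed_strategies_def)
      then have "d * x $ i \<le> d" using d by simp
      moreover have "0 \<le> d * z $ i" using d(1) z by (auto intro: less_imp_le)
      ultimately show ?thesis using d(2)[of i] by (simp add: algebra_simps)
    qed
    moreover have "(\<Sum>i\<in>UNIV. - d * x $ i + (1 + d) * z $ i) = 1"
      using x z by (simp add: mixed_strategies_def sum_subtractf flip: sum_distrib_left)
    ultimately show "(1 - (1 + d)) *\<^sub>R x + (1 + d) *\<^sub>R z \<in> mixed_strategies"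
      by (simp add: mixed_strategies_def)
  qed
  then show "z \<in> rel_interior mixed_strategies"
    using convex_rel_interior_iff[OF convex_mixed_strategies] z by blast
qed

end

theory Submission
  imports Defs
begin

text \<open>Every iterate is nonnegative, so a limit point of the averages vanishes outside its positive
  support. Hence every average close enough to the limit point is
  strictly larger on the support than off it, and any ranking lists the support first.\<close>

text \<open>The prefix has exactly \<open>card S\<close> elements, so if it misses some
  \<open>x\<close> of \<open>S\<close> it must contain some \<open>y\<close> outside
  \<open>S\<close>. Then \<open>y\<close> precedes \<open>x\<close> in the list, and sortedness
  gives \<open>R y x\<close>, which the separation forbids.\<close>

lemma set_take_card_sorted_wrt:
  assumes "distinct xs" "sorted_wrt R xs" "S \<subseteq> set xs"
    and sep: "\<And>x y. x \<in> S \<Longrightarrow> y \<in> set xs - S \<Longrightarrow> \<not> R y x"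
  shows "set (take (card S) xs) = S"
proof -
  let ?T = "set (take (card S) xs)"
  have "card S \<le> length xs"
    using assms(1,3) by (metis card_mono distinct_card finite_set)
  then have card: "card ?T = card S"
    using assms(1) by (simp add: distinct_card)
  have fin: "finite S"
    using assms(3) finite_subset by blast
  have "S \<subseteq> ?T"
  proof (rule ccontr)
    assume "\<not> S \<subseteq> ?T"
    then obtain x where x: "x \<in> S" "x \<notin> ?T" by blast
    \<comment> \<open>Otherwise equal cardinalities would force \<open>?T = S\<close>, contradicting
      the choice of \<open>x\<close>.\<close>
    have "\<not> ?T \<subseteq> S"
      using x fin card card_subset_eq by blast
    then obtain y where y: "y \<in> ?T" "y \<notin> S" by blast
    have "set xs = ?T \<union> set (drop (card S) xs)"
      by (metis append_take_drop_id set_append)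
    then have "x \<in> set (drop (card S) xs)"
      using x assms(3) by blast
    moreover have "sorted_wrt R (take (card S) xs @ drop (card S) xs)"
      using assms(2) by simp
    ultimately have "R y x"
      using y(1) unfolding sorted_wrt_append by blast
    then show False
      using sep[OF x(1)] y set_take_subset by fast
  qed
  then show ?thesis
    using card card_subset_eq by (metis List.finite_set)
qed

text \<open>Strictness is asked only across the border of \<open>S\<close>. Ties within
  \<open>S\<close> or within its complement reorder each block but leave the prefix set unchanged,
  so all rankings agree on it.\<close>

lemma top_ranked_eq_of_separated:
  fixes Y :: "real ^ 'n"
  assumes "is_ranking Y rs" and "\<And>i j. i \<in> S \<Longrightarrow> j \<notin> S \<Longrightarrow> Y $ j < Y $ i"
  shows "set (take (card S) rs) = S"
proof (rule set_take_card_sorted_wrt)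
  show "distinct rs" "sorted_wrt (\<lambda>i j. Y $ i \<ge> Y $ j) rs" "S \<subseteq> set rs"
    using assms(1) by (simp_all add: is_ranking_def)
  show "\<not> Y $ y \<ge> Y $ x" if "x \<in> S" "y \<in> set rs - S" for x y
    using assms(2)[of x y] that by simp
qed

text \<open>For \<open>X = 0\<close> the normaliser is 0; division by zero then gives 0, so the
  bound still holds.\<close>

lemma hedge_nonneg:
  assumes "\<And>i. 0 \<le> X $ i"
  shows "0 \<le> hedge C a X $ i"
  using assms by (simp add: hedge_def sum_nonneg)

lemma weighted_avg_nonneg:
  assumes "\<And>k. 0 \<le> \<alpha> k" "\<And>k. 0 \<le> X k $ i"
  shows "0 \<le> weighted_avg \<alpha> X K $ i"
  using assms by (simp add: weighted_avg_def sum_nonneg)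

lemma limit_point_of_seq_frequently:
  assumes "limit_point_of_seq Y L" and "eventually P (nhds L)"
  shows "\<exists>\<^sub>\<infinity>K. P (Y K)"
proof -
  obtain r where r: "strict_mono r" "(Y \<circ> r) \<longlonglongrightarrow> L"
    using assms(1) by (auto simp: limit_point_of_seq_def)
  have "\<exists>\<^sub>F n in sequentially. P (Y (r n))"
    using eventually_compose_filterlim[OF assms(2) r(2)]
    by (simp add: eventually_frequently)
  moreover have "filterlim r sequentially sequentially"
    using r(1) by (rule filterlim_subseq)
  \<comment> \<open>If \<open>P (Y K)\<close> failed for all large \<open>K\<close>, it would fail
    eventually along \<open>r\<close>, which tends to infinity.\<close>
  ultimately show ?thesis
    unfolding cofinite_eq_sequentially
    using eventually_compose_filterlim[of "\<lambda>K. \<not> P (Y K)"]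
    unfolding frequently_def by blast
qed

text \<open>Nonnegativity makes \<open>L\<close> exactly 0 off its positive support, so the strict
  inequality holds at \<open>L\<close> itself. It is an open condition for each pair, and there are
  only finitely many pairs.\<close>

lemma eventually_nhds_separated:
  fixes L :: "real ^ 'n"
  assumes "\<And>i. 0 \<le> L $ i"
  shows "\<forall>\<^sub>F Y in nhds L. \<forall>i\<in>pos_support L. \<forall>j\<in>- pos_support L. Y $ j < Y $ i"
proof -
  have "\<forall>\<^sub>F Y in nhds L. Y $ j < Y $ i" if "i \<in> pos_support L" "j \<in> - pos_support L" for i j
  proof -
    have lt: "L $ j < L $ i"
      using that assms[of j] by (auto simp: pos_support_def)
    have lim: "((\<lambda>Y. Y $ k) \<longlongrightarrow> L $ k) (nhds L)" for k
      by (intro tendsto_vec_nth filterlim_ident)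
    show ?thesis
      using order_tendstoD(1)[OF tendsto_diff[OF lim[of i] lim[of j]], of 0] lt by simp
  qed
  then show ?thesis
    by (simp add: eventually_ball_finite_distrib)
qed

theorem theorem5:
  fixes C :: "real ^ 'n ^ 'n"
    and \<alpha> :: "nat \<Rightarrow> real"
    and X :: "nat \<Rightarrow> real ^ 'n"
    and Xstar :: "real ^ 'n"
  assumes C_nonneg: "\<And>i j. 0 \<le> C $ i $ j"
    and alpha_pos: "\<And>k. 0 < \<alpha> k"
    and alpha_lim: "\<alpha> \<longlonglongrightarrow> 0"
    and alpha_sum: "filterlim (\<lambda>K. \<Sum>k\<le>K. \<alpha> k) at_top sequentially"
    and alpha_exp_sum: "summable (\<lambda>k. \<alpha> k * (exp (\<alpha> k) - 1))"
    and X_init: "X 0 \<in> rel_interior mixed_strategies"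
    and X_step: "\<And>k. X (Suc k) = hedge C (\<alpha> k) (X k)"
    and Xstar: "limit_point_of_seq (weighted_avg \<alpha> X) Xstar"
  shows "\<exists>\<^sub>\<infinity>K. \<forall>rs. is_ranking (weighted_avg \<alpha> X K) rs \<longrightarrow>
           set (take (card (pos_support Xstar)) rs) = pos_support Xstar"
proof -
  have X_nonneg: "0 \<le> X k $ i" for k i
  proof (induction k arbitrary: i)
    case 0
    then show ?case
      using X_init by (simp add: rel_interior_mixed_strategies less_imp_le)
  next
    case (Suc k)
    then show ?case
      by (simp add: X_step hedge_nonneg)
  qed
  obtain r where "(weighted_avg \<alpha> X \<circ> r) \<longlonglongrightarrow> Xstar"
    using Xstar by (auto simp: limit_point_of_seq_def)
  then have lim: "(\<lambda>n. (weighted_avg \<alpha> X \<circ> r) n $ i) \<longlonglongrightarrow> Xstar $ i" for i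
    by (rule tendsto_vec_nth)
  \<comment> \<open>Each average is nonnegative, and this weak inequality survives the limit along
    \<open>r\<close>.\<close>
  have "0 \<le> Xstar $ i" for i
    using tendsto_lowerbound[OF lim[of i], of 0] weighted_avg_nonneg[of \<alpha> X i]
      X_nonneg alpha_pos by (simp add: less_imp_le)
  from limit_point_of_seq_frequently[OF Xstar eventually_nhds_separated[OF this]]
  show ?thesis
    \<comment> \<open>Whenever the average at \<open>K\<close> is separated, each of its rankings
      starts with the support.\<close>
    by (rule frequently_elim1) (metis ComplI top_ranked_eq_of_separated)
qed

end
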